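(* Let $G$ be a finite simple graph with independence number five. Then the independence fractal $\mathscr{F}(G)$ is a line segment (in $\mathbb{C}$) if and only if the reduced independence polynomial of $G$ is of the form $$f_G(z)=25z+50kz^2+35k^2z^3+10k^3z^4+k^4z^5$$ for some $k\in\{1,2,3,4,5\}$.
   Context: Graphs are finite and simple (no loops or parallel edges). An independent set of $G$ is a set of pairwise non-adjacent vertices; $i_j$ is the number of independent sets of cardinality $j$ in $G$ (so $i_0=1$, $i_1=|V(G)|$); the independence number $\alpha=\alpha(G)$ is the maximum size of an independent set. The independence polynomial is $I_G(z)=i_0+i_1z+i_2z^2+\cdots+i_\alpha z^\alpha$, and the reduced independence polynomial is $f_G(z)=I_G(z)-1=i_1z+i_2z^2+\cdots+i_\alpha z^\alpha$. The lexicographic product $G[H]$ has vertex set $V(G)\times V(H)$, with $(u,v)$ adjacent to $(u',v')$ if $u$ is adjacent to $u'$ in $G$, or $u=u'$ and $v$ is adjacent to $v'$ in $H$. $G^m$ denotes the $m$-fold iterated lexicographic product $G[G[\cdots[G]\cdots]]$; one has $f_{G^m}=f_G^{\circ m}$ ($m$-fold composition). The independence fractal of $G$ is $\mathscr{F}(G)=\lim_{m\to\infty}\mathrm{Roots}(f_{G^m})=\lim_{m\to\infty}f_G^{-m}(0)$, where $\mathrm{Roots}(p)\subset\mathbb{C}$ is the set of complex roots of $p$, $f_G^{-m}(0)=\{z\in\mathbb{C}: f_G^{\circ m}(z)=0\}$, and the limit is in the Hausdorff metric on compact subsets of $\mathbb{C}$. (For $G\neq K_1$ it is known that $\mathscr{F}(G)$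 equals the Julia set of $f_G$.) *)

theory Defs
  imports
    "HOL-Analysis.Analysis"
    "HOL-Computational_Algebra.Polynomial"
    "Graph_Theory.Pair_Digraph"
begin

text \<open>
  A finite simple graph is a \<open>pair_graph\<close>: a finite loop-free digraph whose arc set (a set of
  ordered pairs, hence without parallel arcs) is symmetric.
\<close>

definition indep_set :: "'a pair_pre_digraph \<Rightarrow> 'a set \<Rightarrow> bool" where
  "indep_set G S \<longleftrightarrow> S \<subseteq> pverts G \<and> pairwise (\<lambda>u v. (u, v) \<notin> parcs G) S"

definition num_indep_sets :: "'a pair_pre_digraph \<Rightarrow> nat \<Rightarrow> nat" where
  "num_indep_sets G j = card {S. indep_set G S \<and> card S = j}"

definition independence_number :: "'a pair_pre_digraph \<Rightarrow> nat" where
  "independence_number G = Max {card S |S. indep_set G S}"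

definition indep_poly :: "'a pair_pre_digraph \<Rightarrow> complex poly" where
  "indep_poly G = (\<Sum>j\<le>independence_number G. monom (of_nat (num_indep_sets G j)) j)"

definition reduced_indep_poly :: "'a pair_pre_digraph \<Rightarrow> complex poly" where
  "reduced_indep_poly G = indep_poly G - 1"

definition lex_prod_graph ::
    "'a pair_pre_digraph \<Rightarrow> 'b pair_pre_digraph \<Rightarrow> ('a \<times> 'b) pair_pre_digraph" where
  "lex_prod_graph G H =
    \<lparr> pverts = pverts G \<times> pverts H,
      parcs = {((u, v), (u', v')) |u v u' v'.
        (u, v) \<in> pverts G \<times> pverts H \<and> (u', v') \<in> pverts G \<times> pverts H \<and>
        ((u, u') \<in> parcs G \<or> u = u' \<and> (v, v') \<in> parcs H)} \<rparr>"

definition relabel_graph :: "('a \<Rightarrow> 'b) \<Rightarrow> 'a pair_pre_digraph \<Rightarrow> 'b pair_pre_digraph" where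
  "relabel_graph h G = \<lparr> pverts = h ` pverts G, parcs = map_prod h h ` parcs G \<rparr>"

text \<open>
  The vertex type of an iterated product would grow with the number of factors, so the vertices
  of the \<open>m\<close>-th power are represented as lists of length \<open>m\<close>: a vertex \<open>(u, us)\<close> of
  \<open>G[G\<^sup>m]\<close> becomes the list \<open>u # us\<close>. The zeroth power is the one-vertex graph, the unit of the
  product up to isomorphism.
\<close>

primrec lex_power :: "'a pair_pre_digraph \<Rightarrow> nat \<Rightarrow> 'a list pair_pre_digraph" where
  "lex_power G 0 = \<lparr> pverts = {[]}, parcs = {} \<rparr>"
| "lex_power G (Suc m) = relabel_graph (\<lambda>(u, us). u # us) (lex_prod_graph G (lex_power G m))"

text \<open>The Hausdorff distance; it is a metric only on nonempty compact sets.\<close>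

definition hausdorff_dist :: "'a::metric_space set \<Rightarrow> 'a set \<Rightarrow> real" where
  "hausdorff_dist S T = max (SUP x\<in>S. infdist x T) (SUP y\<in>T. infdist y S)"

definition hausdorff_lim :: "(nat \<Rightarrow> 'a::metric_space set) \<Rightarrow> 'a set" where
  "hausdorff_lim X =
    (THE K. compact K \<and> K \<noteq> {} \<and> (\<lambda>m. hausdorff_dist (X m) K) \<longlonglongrightarrow> 0)"

definition independence_fractal :: "'a pair_pre_digraph \<Rightarrow> complex set" where
  "independence_fractal G =
    hausdorff_lim (\<lambda>m. {z. poly (reduced_indep_poly (lex_power G m)) z = 0})"

end

theory Submission
  imports Defs "HOL-Computational_Algebra.Fundamental_Theorem_Algebra"
begin

text \<open>
  Write \<open>f\<close> for the reduced independence polynomial of \<open>G\<close>. Independent sets of a lexicographic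
  product fibre over independent sets of the first factor, so the powers of \<open>G\<close> have the iterates
  of \<open>f\<close> as reduced independence polynomials (\<open>poly_reduced_lex_power\<close>). Since \<open>f\<close> fixes \<open>0\<close>, the
  root sets of the iterates increase. They are uniformly bounded, so their Hausdorff limit exists
  and is the closure \<open>K\<close> of the backward orbit of \<open>0\<close> (\<open>independence_fractal_eq\<close>). This set is
  completely invariant: \<open>f z \<in> K\<close> if and only if \<open>z \<in> K\<close> (\<open>closure_backward_orbit_invariant\<close>).

  Suppose that \<open>K\<close> is a segment. It contains \<open>0\<close> and all roots of \<open>f\<close>. The coefficients of \<open>f\<close> are
  positive, so the sum of the roots is a negative real number and no iterate has a positive root;
  therefore \<open>K = [-L, 0]\<close> with \<open>L > 0\<close> (\<open>segment_backward_orbit_is_real\<close>). A polynomial for which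
  \<open>[-L, 0]\<close> is completely invariant satisfies the Chebyshev differential equation
  \<open>d\<^sup>2 f (f + L) = x (x + L) f'\<^sup>2\<close> (\<open>invariant_segment_chebyshev_equation\<close>), and for \<open>d = 5\<close> comparing
  coefficients yields the stated form with \<open>k = 4 / L\<close>. Finally \<open>k\<close> is an integer because \<open>50 k\<close> and
  \<open>k\<^sup>4\<close> count independent sets, and \<open>k \<le> 5\<close> because \<open>G\<close> has \<open>25\<close> vertices and fewer than \<open>300\<close>
  independent pairs.

  Conversely, a polynomial of the stated form maps \<open>-(4/k) sin\<^sup>2 t\<close> to \<open>-(4/k) sin\<^sup>2 (5 t)\<close>. The backward
  orbit of \<open>0\<close> consists of the points with \<open>t = j \<pi> / 5\<^sup>m\<close>, which are dense in \<open>[-4/k, 0]\<close>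
  (\<open>closure_backward_orbit_chebyshev5\<close>).
\<close>

section \<open>Independence polynomials and lexicographic products\<close>

lemma indep_set_empty: "indep_set G {}"
  by (simp add: indep_set_def)

lemma indep_set_subset: "indep_set G S \<Longrightarrow> T \<subseteq> S \<Longrightarrow> indep_set G T"
  unfolding indep_set_def by (auto intro: pairwise_subset)

lemma finite_indep_sets:
  assumes "finite (pverts G)"
  shows "finite {S. indep_set G S}"
  by (rule finite_subset[of _ "Pow (pverts G)"]) (use assms in \<open>auto simp: indep_set_def\<close>)

lemma finite_indep_set: "finite (pverts G) \<Longrightarrow> indep_set G S \<Longrightarrow> finite S"
  by (auto simp: indep_set_def intro: finite_subset)

lemma card_le_independence_number:
  assumes "finite (pverts G)" "indep_set G S"
  shows "card S \<le> independence_number G"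
proof -
  have "finite {card S |S. indep_set G S}"
    using finite_indep_sets[OF assms(1)] by (simp add: setcompr_eq_image)
  then show ?thesis
    unfolding independence_number_def by (rule Max_ge) (use assms(2) in auto)
qed

lemma independence_number_attained:
  assumes "finite (pverts G)"
  shows "\<exists>S. indep_set G S \<and> card S = independence_number G"
proof -
  have "finite {card S |S. indep_set G S}"
    using finite_indep_sets[OF assms] by (simp add: setcompr_eq_image)
  then have "independence_number G \<in> {card S |S. indep_set G S}"
    unfolding independence_number_def by (rule Max_in) (use indep_set_empty in auto)
  then show ?thesis by auto
qed

lemma num_indep_sets_0:
  assumes "finite (pverts G)"
  shows "num_indep_sets G 0 = 1"
proof -
  have "{S. indep_set G S \<and> card S = 0} = {{}}"
    using finite_indep_set[OF assms] indep_set_empty[of G] by auto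
  then show ?thesis by (simp add: num_indep_sets_def)
qed

lemma num_indep_sets_pos:
  assumes "finite (pverts G)" "j \<le> independence_number G"
  shows "num_indep_sets G j > 0"
proof -
  obtain S where S: "indep_set G S" "card S = independence_number G"
    using independence_number_attained[OF assms(1)] by blast
  then obtain T where "T \<subseteq> S" "card T = j"
    using obtain_subset_with_card_n[of j S] assms(2) by auto
  then have "T \<in> {S. indep_set G S \<and> card S = j}"
    using indep_set_subset[OF S(1)] by auto
  moreover have "finite {S. indep_set G S \<and> card S = j}"
    using finite_indep_sets[OF assms(1)] by simp
  ultimately show ?thesis
    unfolding num_indep_sets_def by (auto simp: card_gt_0_iff)
qed

text \<open>
  If every pair of vertices were independent, then the whole vertex set would be independent.
\<close>

lemma num_indep_sets_2_less:
  assumes "finite (pverts G)" "independence_number G < card (pverts G)"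
  shows "num_indep_sets G 2 < card (pverts G) choose 2"
proof -
  let ?V = "pverts G" and ?I = "{S. indep_set G S \<and> card S = 2}"
  let ?P = "{S. S \<subseteq> ?V \<and> card S = 2}"
  have "\<not> indep_set G ?V"
    using card_le_independence_number[OF assms(1), of ?V] assms(2) by auto
  then obtain u v where uv: "u \<in> ?V" "v \<in> ?V" "u \<noteq> v" "(u, v) \<in> parcs G"
    unfolding indep_set_def pairwise_def by auto
  then have "{u, v} \<in> ?P - ?I"
    by (auto simp: indep_set_def pairwise_def)
  moreover have "?I \<subseteq> ?P" by (auto simp: indep_set_def)
  ultimately have "?I \<subset> ?P" by blast
  then have "card ?I < card ?P"
    by (rule psubset_card_mono[rotated]) (use assms(1) in auto)
  then show ?thesis
    using n_subsets[OF assms(1), of 2] by (simp add: num_indep_sets_def)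
qed

lemma num_indep_sets_1: "num_indep_sets G 1 = card (pverts G)"
proof -
  have "{S. indep_set G S \<and> card S = 1} = (\<lambda>v. {v}) ` pverts G"
    by (auto simp: indep_set_def card_1_singleton_iff)
  moreover have "inj_on (\<lambda>v. {v}) (pverts G)" by auto
  ultimately show ?thesis by (simp add: num_indep_sets_def card_image)
qed

lemma coeff_reduced_indep_poly:
  assumes "finite (pverts G)"
  shows "coeff (reduced_indep_poly G) j =
    (if 1 \<le> j \<and> j \<le> independence_number G then of_nat (num_indep_sets G j) else 0)"
proof -
  have "coeff (indep_poly G) j = (if j \<le> independence_number G then of_nat (num_indep_sets G j) else 0)"
    by (simp add: indep_poly_def coeff_sum)
  then show ?thesis
    using num_indep_sets_0[OF assms]
    by (cases "j = 0") (auto simp: reduced_indep_poly_def)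
qed

text \<open>
  Evaluating as a sum over nonempty independent sets avoids all bookkeeping of degrees and
  coefficients in products of graphs.
\<close>

lemma poly_reduced_indep_poly:
  assumes "finite (pverts G)"
  shows "poly (reduced_indep_poly G) z = (\<Sum>S | indep_set G S \<and> S \<noteq> {}. z ^ card S)"
proof -
  let ?I = "{S. indep_set G S}"
  have fin: "finite ?I" by (rule finite_indep_sets[OF assms])
  have "poly (indep_poly G) z =
      (\<Sum>j\<le>independence_number G. of_nat (num_indep_sets G j) * z ^ j)"
    by (simp add: indep_poly_def poly_sum poly_monom)
  also have "\<dots> = (\<Sum>j\<le>independence_number G. \<Sum>S\<in>{S \<in> ?I. card S = j}. z ^ card S)"
    by (simp add: num_indep_sets_def)
  also have "\<dots> = (\<Sum>S\<in>?I. z ^ card S)"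
    by (rule sum.group) (use fin card_le_independence_number[OF assms] in auto)
  also have "\<dots> = 1 + (\<Sum>S\<in>?I - {{}}. z ^ card S)"
    using sum.remove[OF fin, of "{}" "\<lambda>S. z ^ card S"] indep_set_empty by auto
  also have "?I - {{}} = {S. indep_set G S \<and> S \<noteq> {}}" by auto
  finally show ?thesis by (simp add: reduced_indep_poly_def)
qed

text \<open>
  A nonempty independent set of \<open>G[H]\<close> is the same as a nonempty independent set \<open>T\<close> of \<open>G\<close>, its
  projection, with a nonempty independent set of \<open>H\<close> chosen in the fibre over each vertex of \<open>T\<close>.
  Loops of \<open>G\<close> would turn the fibres into cliques.
\<close>

lemma poly_reduced_lex_prod:
  assumes fG: "finite (pverts G)" and fH: "finite (pverts H)"
    and loopfree: "\<And>u. (u, u) \<notin> parcs G"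
  shows "poly (reduced_indep_poly (lex_prod_graph G H)) z =
    poly (reduced_indep_poly G) (poly (reduced_indep_poly H) z)"
proof -
  let ?L = "lex_prod_graph G H"
  let ?IG = "{T. indep_set G T \<and> T \<noteq> {}}" and ?IH = "{S. indep_set H S \<and> S \<noteq> {}}"
  let ?IL = "{W. indep_set ?L W \<and> W \<noteq> {}}"
  let ?J = "SIGMA T:?IG. Pi\<^sub>E T (\<lambda>_. ?IH)"
  define glue :: "'a set \<times> ('a \<Rightarrow> 'b set) \<Rightarrow> ('a \<times> 'b) set"
    where "glue = (\<lambda>(T, F). Sigma T F)"
  define split :: "('a \<times> 'b) set \<Rightarrow> 'a set \<times> ('a \<Rightarrow> 'b set)"
    where "split = (\<lambda>W. (fst ` W, \<lambda>u\<in>fst ` W. {v. (u, v) \<in> W}))"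
  have verts: "pverts ?L = pverts G \<times> pverts H"
    by (simp add: lex_prod_graph_def)
  have arcs: "((u, v), (u', v')) \<in> parcs ?L \<longleftrightarrow> u \<in> pverts G \<and> v \<in> pverts H \<and>
      u' \<in> pverts G \<and> v' \<in> pverts H \<and> ((u, u') \<in> parcs G \<or> u = u' \<and> (v, v') \<in> parcs H)"
    for u v u' v' by (auto simp: lex_prod_graph_def)
  have finG: "finite ?IG" and finH: "finite ?IH"
    using finite_indep_sets[OF fG] finite_indep_sets[OF fH] by simp_all
  have finT: "finite T" if "T \<in> ?IG" for T
    using that finite_indep_set[OF fG] by auto

  have glue_in: "glue x \<in> ?IL" if "x \<in> ?J" for x
  proof -
    obtain T F where x: "x = (T, F)" "T \<in> ?IG" "F \<in> Pi\<^sub>E T (\<lambda>_. ?IH)" using \<open>x \<in> ?J\<close> by blast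
    have F: "indep_set H (F u)" "F u \<noteq> {}" if "u \<in> T" for u
      using x(3) that by auto
    have "((u, v), (u', v')) \<notin> parcs ?L"
      if "u \<in> T" "v \<in> F u" "u' \<in> T" "v' \<in> F u'" "(u, v) \<noteq> (u', v')" for u v u' v'
    proof (cases "u = u'")
      case True
      then show ?thesis
        using F(1)[OF that(1)] that loopfree[of u] by (auto simp: arcs indep_set_def pairwise_def)
    next
      case False
      then show ?thesis
        using x(2) that by (auto simp: arcs indep_set_def pairwise_def)
    qed
    moreover have "Sigma T F \<subseteq> pverts ?L"
      using x(2) F(1) unfolding verts indep_set_def by blast
    moreover have "Sigma T F \<noteq> {}" using x(2) F(2) by auto
    ultimately show ?thesis
      unfolding x(1) glue_def indep_set_def pairwise_def by auto
  qed
  have split_in: "split W \<in> ?J" if "W \<in> ?IL" for W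
  proof -
    have W: "W \<subseteq> pverts G \<times> pverts H" "W \<noteq> {}"
      "\<And>x y. x \<in> W \<Longrightarrow> y \<in> W \<Longrightarrow> x \<noteq> y \<Longrightarrow> (x, y) \<notin> parcs ?L"
      using that verts by (auto simp: indep_set_def pairwise_def)
    have "(u, u') \<notin> parcs G" if "(u, v) \<in> W" "(u', v') \<in> W" "u \<noteq> u'" for u u' v v'
      using W(3)[OF that(1,2)] W(1) that by (auto simp: arcs)
    then have "indep_set G (fst ` W)"
      using W(1) by (fastforce simp: indep_set_def pairwise_def)
    moreover have "(v, v') \<notin> parcs H" if "(u, v) \<in> W" "(u, v') \<in> W" "v \<noteq> v'" for u v v'
      using W(3)[OF that(1,2)] W(1) that by (auto simp: arcs)
    then have "indep_set H {v. (u, v) \<in> W}" for u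
      using W(1) by (fastforce simp: indep_set_def pairwise_def)
    moreover have "{v. (u, v) \<in> W} \<noteq> {}" if "u \<in> fst ` W" for u
      using that by auto
    ultimately show ?thesis
      using W(2) unfolding split_def by (auto simp del: Collect_empty_eq)
  qed
  have split_glue: "split (glue x) = x" if "x \<in> ?J" for x
  proof -
    obtain T F where x: "x = (T, F)" "F \<in> Pi\<^sub>E T (\<lambda>_. ?IH)" using \<open>x \<in> ?J\<close> by blast
    have "fst ` Sigma T F = T" using x(2) by force
    moreover have "(\<lambda>u\<in>T. {v. (u, v) \<in> Sigma T F}) = F"
      by (rule extensionalityI[of _ T]) (use x(2) in \<open>auto simp: PiE_def\<close>)
    ultimately show ?thesis by (simp add: x(1) glue_def split_def)
  qed
  have "u \<in> fst ` W" if "(u, v) \<in> W" for u v and W :: "('a \<times> 'b) set"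
    using that by force
  then have glue_split: "glue (split W) = W" for W
    by (auto simp: glue_def split_def split: if_splits)

  have "poly (reduced_indep_poly ?L) z = (\<Sum>W\<in>?IL. z ^ card W)"
    by (rule poly_reduced_indep_poly) (simp add: verts fG fH)
  also have "\<dots> = (\<Sum>(T, F)\<in>?J. \<Prod>u\<in>T. z ^ card (F u))"
  proof (rule sum.reindex_bij_witness[of _ glue split])
    fix W assume W: "W \<in> ?IL"
    have J: "split W \<in> ?J" by (rule split_in[OF W])
    obtain T F where TF: "split W = (T, F)" by fastforce
    with J have T: "T \<in> ?IG" and F: "F \<in> Pi\<^sub>E T (\<lambda>_. ?IH)" by auto
    have "finite (F u)" if "u \<in> T" for u
      using F that finite_indep_set[OF fH] by auto
    then have "card (Sigma T F) = (\<Sum>u\<in>T. card (F u))"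
      using finT[OF T] by (intro card_SigmaI) auto
    then have "card W = (\<Sum>u\<in>T. card (F u))"
      using glue_split[of W] by (simp add: TF glue_def)
    then show "(case split W of (T, F) \<Rightarrow> \<Prod>u\<in>T. z ^ card (F u)) = z ^ card W"
      by (simp add: TF power_sum)
  qed (use glue_in split_in split_glue glue_split in auto)
  also have "\<dots> = (\<Sum>T\<in>?IG. \<Sum>F\<in>Pi\<^sub>E T (\<lambda>_. ?IH). \<Prod>u\<in>T. z ^ card (F u))"
    by (rule sum.Sigma[symmetric]) (use finG finH finT in \<open>auto intro!: finite_PiE\<close>)
  also have "\<dots> = (\<Sum>T\<in>?IG. \<Prod>u\<in>T. \<Sum>S\<in>?IH. z ^ card S)"
    by (rule sum.cong[OF refl], rule prod_sum_PiE[symmetric]) (use finH finT in auto)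
  also have "\<dots> = (\<Sum>T\<in>?IG. poly (reduced_indep_poly H) z ^ card T)"
    by (simp add: poly_reduced_indep_poly[OF fH])
  also have "\<dots> = poly (reduced_indep_poly G) (poly (reduced_indep_poly H) z)"
    by (rule poly_reduced_indep_poly[OF fG, symmetric])
  finally show ?thesis .
qed

lemma indep_set_relabel:
  assumes "inj h" "finite (pverts G)"
  shows "{S. indep_set (relabel_graph h G) S \<and> S \<noteq> {}} = (`) h ` {S. indep_set G S \<and> S \<noteq> {}}"
proof -
  have image: "indep_set (relabel_graph h G) (h ` S) \<longleftrightarrow> indep_set G S" for S
  proof -
    have "(h u, h v) \<in> map_prod h h ` parcs G \<longleftrightarrow> (u, v) \<in> parcs G" for u v
      using inj_image_mem_iff[OF prod.inj_map[OF assms(1,1)], of "(u, v)"] by simp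
    moreover have "h ` S \<subseteq> h ` pverts G \<longleftrightarrow> S \<subseteq> pverts G"
      by (rule inj_image_subset_iff[OF assms(1)])
    ultimately show ?thesis
      using inj_eq[OF assms(1)] by (simp add: indep_set_def relabel_graph_def pairwise_def)
  qed
  have "\<exists>S. W = h ` S" if "indep_set (relabel_graph h G) W" for W
    using that by (auto simp: indep_set_def relabel_graph_def subset_image_iff)
  then show ?thesis using image by blast
qed

lemma poly_reduced_relabel:
  assumes "inj h" "finite (pverts G)"
  shows "poly (reduced_indep_poly (relabel_graph h G)) z = poly (reduced_indep_poly G) z"
proof -
  have fin: "finite (pverts (relabel_graph h G))"
    using assms(2) by (simp add: relabel_graph_def)
  have "inj_on ((`) h) A" for A :: "'a set set"
    using assms(1) by (meson inj_image_eq_iff inj_onI)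
  then show ?thesis
    by (simp add: poly_reduced_indep_poly[OF fin] poly_reduced_indep_poly[OF assms(2)]
      indep_set_relabel[OF assms] sum.reindex card_image[OF inj_on_subset[OF assms(1)]])
qed

lemma finite_pverts_lex_power: "finite (pverts G) \<Longrightarrow> finite (pverts (lex_power G m))"
  by (induction m) (simp_all add: relabel_graph_def lex_prod_graph_def)

lemma poly_reduced_lex_power:
  assumes "finite (pverts G)" and "\<And>u. (u, u) \<notin> parcs G"
  shows "poly (reduced_indep_poly (lex_power G m)) z = (poly (reduced_indep_poly G) ^^ m) z"
proof (induction m)
  case 0
  have "{S. indep_set (lex_power G 0) S \<and> S \<noteq> {}} = {{[]}}"
    by (auto simp: indep_set_def subset_singleton_iff)
  then show ?case
    using poly_reduced_indep_poly[of "lex_power G 0" z] by simp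
next
  case (Suc m)
  have "inj (\<lambda>(u :: 'a, us). u # us)" by (auto simp: inj_def)
  moreover have "finite (pverts (lex_prod_graph G (lex_power G m)))"
    using assms(1) finite_pverts_lex_power[of G m] by (simp add: lex_prod_graph_def)
  ultimately show ?case
    using poly_reduced_lex_prod[OF assms(1) finite_pverts_lex_power[OF assms(1)] assms(2)]
    by (simp add: poly_reduced_relabel Suc.IH)
qed

section \<open>Hausdorff limits of increasing sequences\<close>

lemma
  fixes S T :: "'a::metric_space set"
  assumes "bounded S" "bounded T" "T \<noteq> {}"
  shows infdist_le_hausdorff_dist: "x \<in> S \<Longrightarrow> infdist x T \<le> hausdorff_dist S T"
    and hausdorff_dist_commute: "hausdorff_dist T S = hausdorff_dist S T"
proof -
  obtain a where "a \<in> T" using assms(3) by blast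
  obtain e where "\<And>y. y \<in> S \<Longrightarrow> dist a y \<le> e"
    using assms(1) bounded_any_center[of S a] by auto
  then have "bdd_above ((\<lambda>x. infdist x T) ` S)"
    using infdist_le[OF \<open>a \<in> T\<close>]
    by (intro bdd_aboveI2[of _ _ e]) (metis dist_commute order_trans)
  then show "infdist x T \<le> hausdorff_dist S T" if "x \<in> S"
    unfolding hausdorff_dist_def using cSUP_upper[OF that] by fastforce
qed (simp add: hausdorff_dist_def max.commute)

text \<open>
  By symmetry a sequence has at most one nonempty compact limit, so the definite description in the
  definition of the Hausdorff limit denotes any limit that can be exhibited.
\<close>

lemma compact_subset_of_hausdorff_limits:
  fixes X :: "nat \<Rightarrow> 'a::metric_space set"
  assumes X: "\<And>m. bounded (X m)" "\<And>m. X m \<noteq> {}"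
    and K: "compact K" "(\<lambda>m. hausdorff_dist (X m) K) \<longlonglongrightarrow> 0"
    and K': "compact K'" "K' \<noteq> {}" "(\<lambda>m. hausdorff_dist (X m) K') \<longlonglongrightarrow> 0"
  shows "K \<subseteq> K'"
proof
  fix x assume x: "x \<in> K"
  then have "K \<noteq> {}" by auto
  have le: "infdist x K' \<le> hausdorff_dist (X m) K + hausdorff_dist (X m) K'" for m
  proof (rule field_le_epsilon)
    fix e :: real assume "e > 0"
    have "infdist x (X m) \<le> hausdorff_dist (X m) K"
      using infdist_le_hausdorff_dist[OF compact_imp_bounded[OF K(1)] X(1) X(2) x]
        hausdorff_dist_commute[OF X(1) compact_imp_bounded[OF K(1)] \<open>K \<noteq> {}\<close>] by simp
    then have "infdist x (X m) < hausdorff_dist (X m) K + e" using \<open>e > 0\<close> by simp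
    then obtain y where y: "y \<in> X m" "dist x y < hausdorff_dist (X m) K + e"
      using cInf_lessD[of "dist x ` X m"] X(2)[of m] by (auto simp: infdist_notempty)
    have "infdist x K' \<le> infdist y K' + dist x y" by (rule infdist_triangle)
    also have "infdist y K' \<le> hausdorff_dist (X m) K'"
      by (rule infdist_le_hausdorff_dist[OF X(1) compact_imp_bounded[OF K'(1)] K'(2) y(1)])
    finally show "infdist x K' \<le> hausdorff_dist (X m) K + hausdorff_dist (X m) K' + e"
      using y(2) by simp
  qed
  have "(\<lambda>m. hausdorff_dist (X m) K + hausdorff_dist (X m) K') \<longlonglongrightarrow> 0"
    using tendsto_add[OF K(2) K'(3)] by simp
  then have "infdist x K' \<le> 0"
    by (rule LIMSEQ_le_const) (use le in blast)
  then have "infdist x K' = 0"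
    using infdist_nonneg[of x K'] by linarith
  then show "x \<in> K'"
    using in_closed_iff_infdist_zero[OF compact_imp_closed[OF K'(1)] K'(2)] by simp
qed

text \<open>
  Finitely many points of the union approximate its closure to within any given precision, and
  they all lie in one member of the increasing sequence.
\<close>

lemma hausdorff_lim_increasing:
  fixes X :: "nat \<Rightarrow> 'a::heine_borel set"
  assumes ne: "X 0 \<noteq> {}" and mono: "mono X" and bdd: "bounded (\<Union>m. X m)"
  shows "hausdorff_lim X = closure (\<Union>m. X m)"
proof -
  let ?U = "\<Union>m. X m"
  let ?K = "closure ?U"
  have X: "bounded (X m)" "X m \<noteq> {}" for m
  proof -
    show "bounded (X m)" by (rule bounded_subset[OF bdd]) auto
    show "X m \<noteq> {}" using ne monoD[OF mono, of 0 m] by auto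
  qed
  have K: "compact ?K" using bdd by (simp add: compact_closure)
  have Kne: "?K \<noteq> {}" using ne by auto
  have sub: "X m \<subseteq> ?K" for m
    by (rule order_trans[OF _ closure_subset]) auto
  have lim: "(\<lambda>m. hausdorff_dist (X m) ?K) \<longlonglongrightarrow> 0"
  proof (rule LIMSEQ_I)
    fix e :: real assume e: "e > 0"
    have "?K \<subseteq> (\<Union>y\<in>?U. ball y (e / 2))"
    proof
      fix x assume "x \<in> ?K"
      then obtain y where "y \<in> ?U" "dist y x < e / 2"
        unfolding closure_approachable using e half_gt_zero by blast
      then show "x \<in> (\<Union>y\<in>?U. ball y (e / 2))" by auto
    qed
    then obtain F where F: "F \<subseteq> ?U" "finite F" "?K \<subseteq> (\<Union>y\<in>F. ball y (e / 2))"
      using compactE_image[OF K, of ?U "\<lambda>y. ball y (e / 2)"] by auto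
    have "\<forall>y\<in>F. \<exists>m. y \<in> X m" using F(1) by auto
    then obtain n where n: "\<And>y. y \<in> F \<Longrightarrow> y \<in> X (n y)" by metis
    define M where "M = Max (insert 0 (n ` F))"
    have "hausdorff_dist (X m) ?K \<le> e / 2 \<and> 0 \<le> hausdorff_dist (X m) ?K" if m: "m \<ge> M" for m
    proof -
      have FX: "F \<subseteq> X m"
      proof
        fix y assume y: "y \<in> F"
        then have "n y \<le> M" unfolding M_def using F(2) by (intro Max_ge) auto
        then show "y \<in> X m" using n[OF y] monoD[OF mono, of "n y" m] m by auto
      qed
      have "infdist x (X m) \<le> e / 2" if "x \<in> ?K" for x
      proof -
        have "x \<in> (\<Union>y\<in>F. ball y (e / 2))" using F(3) that by blast
        then obtain y where "y \<in> F" "dist y x < e / 2" by auto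
        then show ?thesis
          using FX by (intro infdist_le2[of y]) (auto simp: dist_commute)
      qed
      then have "(SUP x\<in>?K. infdist x (X m)) \<le> e / 2" by (rule cSUP_least[OF Kne])
      moreover have "(SUP x\<in>X m. infdist x ?K) = 0"
        using sub[of m] X(2)[of m] by (simp add: subset_iff cong: SUP_cong)
      ultimately show ?thesis using e by (auto simp: hausdorff_dist_def)
    qed
    then show "\<exists>M. \<forall>m\<ge>M. norm (hausdorff_dist (X m) ?K - 0) < e"
      using e by (intro exI[of _ M]) fastforce
  qed
  show ?thesis
    unfolding hausdorff_lim_def
  proof (rule the_equality)
    fix K' assume K': "compact K' \<and> K' \<noteq> {} \<and> (\<lambda>m. hausdorff_dist (X m) K') \<longlonglongrightarrow> 0"
    show "K' = ?K"
      by (intro equalityI compact_subset_of_hausdorff_limits[where X = X])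
        (use X K Kne lim K' in auto)
  qed (use K Kne lim in blast)
qed

section \<open>The backward orbit of a fixed point\<close>

definition backward_orbit :: "complex poly \<Rightarrow> complex set" where
  "backward_orbit f = (\<Union>m. {z. (poly f ^^ m) z = 0})"

lemma backward_orbit_iff: "z \<in> backward_orbit f \<longleftrightarrow> (\<exists>m. (poly f ^^ m) z = 0)"
  by (simp add: backward_orbit_def)

lemma zero_in_backward_orbit: "0 \<in> backward_orbit f"
  unfolding backward_orbit_iff by (rule exI[of _ 0]) simp

lemma roots_in_backward_orbit: "poly f z = 0 \<Longrightarrow> z \<in> backward_orbit f"
  unfolding backward_orbit_iff by (rule exI[of _ 1]) simp

lemma backward_orbit_invariant:
  assumes "poly f 0 = 0"
  shows "poly f z \<in> backward_orbit f \<longleftrightarrow> z \<in> backward_orbit f"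
proof
  assume "poly f z \<in> backward_orbit f"
  then obtain m where "(poly f ^^ m) (poly f z) = 0" by (auto simp: backward_orbit_iff)
  then have "(poly f ^^ Suc m) z = 0" by (simp add: funpow_swap1)
  then show "z \<in> backward_orbit f" unfolding backward_orbit_iff by blast
next
  assume "z \<in> backward_orbit f"
  then obtain m where "(poly f ^^ m) z = 0" by (auto simp: backward_orbit_iff)
  then have "(poly f ^^ m) (poly f z) = 0" using assms by (simp flip: funpow_swap1)
  then show "poly f z \<in> backward_orbit f" unfolding backward_orbit_iff by blast
qed

text \<open>Far from the origin a polynomial of degree at least two moves points outwards.\<close>

lemma bounded_backward_orbit:
  assumes "degree f \<ge> 2" "poly f 0 = 0"
  shows "bounded (backward_orbit f)"
proof -
  obtain c q where f: "f = pCons c q" by (cases f)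
  obtain b q' where q: "q = pCons b q'" by (cases q)
  have "c = 0" using assms(2) by (simp add: f)
  have "q' \<noteq> 0" using assms(1) by (auto simp: f q degree_pCons_eq_if split: if_splits)
  then obtain r where r: "\<And>z. r \<le> norm z \<Longrightarrow> 2 \<le> norm (poly q z)"
    using poly_infinity[of q' 2 b] unfolding q by blast
  define R where "R = max r 1"
  have step: "norm (poly f z) > R" if "norm z > R" for z
  proof -
    have "2 \<le> norm (poly q z)" using r that by (simp add: R_def)
    then have "norm z * 2 \<le> norm (poly f z)"
      by (simp add: f \<open>c = 0\<close> norm_mult mult_left_mono)
    then show ?thesis using that by (simp add: R_def)
  qed
  have "norm ((poly f ^^ m) z) > R" if "norm z > R" for m z
    by (induction m) (use that step in auto)
  then have "norm z \<le> R" if "z \<in> backward_orbit f" for z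
    using that unfolding backward_orbit_iff
    by (metis R_def max.cobounded2 norm_zero not_le not_one_less_zero order_less_trans order_le_less_trans)
  then show ?thesis by (auto simp: bounded_iff)
qed

text \<open>
  The value of a polynomial is, up to the leading coefficient, the product of the distances to
  its roots; hence a small value forces a nearby root.
\<close>

lemma exists_root_nearby:
  fixes p :: "complex poly"
  assumes "degree p > 0"
  shows "\<exists>r. poly p r = 0 \<and> norm (lead_coeff p) * dist z r ^ degree p \<le> norm (poly p z)"
proof -
  have "p \<noteq> 0" using assms by auto
  then obtain A where A: "size A = degree p"
      "p = smult (lead_coeff p) (\<Prod>x\<in>#A. [:-x, 1:])"
    using alg_closed_imp_factorization by blast
  have "set_mset A \<noteq> {}" using A(1) assms by auto
  then obtain r where "is_arg_min (dist z) (\<lambda>x. x \<in> set_mset A) r"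
    using ex_is_arg_min_if_finite[of "set_mset A" "dist z"] by auto
  then have r: "r \<in># A" "\<And>x. x \<in># A \<Longrightarrow> dist z r \<le> dist z x"
    by (auto simp: is_arg_min_linorder)
  have le: "dist z r ^ size B \<le> (\<Prod>x\<in>#B. dist z x)" if "B \<subseteq># A" for B
    using that
  proof (induction B)
    case (add x B)
    then have "B \<subseteq># A" "x \<in># A"
      by (auto dest: mset_subset_eq_insertD simp: subset_mset.less_imp_le)
    then show ?case
      using add.IH r(2)[of x] by (simp add: mult_mono)
  qed simp
  have eval: "poly (\<Prod>x\<in>#B. [:-x, 1:]) w = (\<Prod>x\<in>#B. w - x)" for B and w :: complex
    by (induction B) (auto simp: algebra_simps)
  have norm: "norm (\<Prod>x\<in>#B. w - x) = (\<Prod>x\<in>#B. dist w x)" for B and w :: complex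
    by (induction B) (auto simp: norm_mult dist_norm)
  have p: "poly p w = lead_coeff p * (\<Prod>x\<in>#A. w - x)" for w
    by (subst A(2)) (simp add: eval)
  have "(\<Prod>x\<in>#A. r - x) = 0" using r(1) by (auto simp: prod_mset_zero_iff)
  then have "poly p r = 0" by (simp add: p)
  moreover have "norm (lead_coeff p) * dist z r ^ degree p \<le> norm (poly p z)"
    using le[of A] unfolding p norm_mult norm A(1)[symmetric] by (simp add: mult_left_mono)
  ultimately show ?thesis by blast
qed

text \<open>
  Complete invariance passes to the closure: forwards by continuity, backwards because the roots
  of \<open>f - w\<close> depend continuously on \<open>w\<close>.
\<close>

lemma closure_backward_orbit_invariant:
  assumes deg: "degree f > 0" and zero: "poly f 0 = 0"
  shows "poly f z \<in> closure (backward_orbit f) \<longleftrightarrow> z \<in> closure (backward_orbit f)"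
proof
  let ?U = "backward_orbit f"
  assume "z \<in> closure ?U"
  moreover have "poly f ` closure ?U \<subseteq> closure ?U"
    by (rule image_closure_subset)
      (use backward_orbit_invariant[OF zero] closure_subset[of ?U]
        in \<open>auto intro!: continuous_intros\<close>)
  ultimately show "poly f z \<in> closure ?U" by blast
next
  let ?U = "backward_orbit f" and ?n = "degree f" and ?c = "norm (lead_coeff f)"
  assume fz: "poly f z \<in> closure ?U"
  have c: "?c > 0" using deg by auto
  have "\<exists>y\<in>?U. dist y z < e" if e: "e > 0" for e
  proof -
    have "?c * e ^ ?n > 0" using c e by simp
    then obtain w where w: "w \<in> ?U" "dist w (poly f z) < ?c * e ^ ?n"
      using fz unfolding closure_approachable by blast
    define p where "p = f + [:- w:]"
    have deg_p: "degree p = ?n" using deg by (simp add: p_def degree_add_eq_left)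
    have p: "degree p = ?n" "lead_coeff p = lead_coeff f" "poly p x = poly f x - w" for x
      unfolding deg_p using deg by (auto simp: p_def coeff_pCons split: nat.splits)
    obtain r where r: "poly p r = 0" "?c * dist z r ^ ?n \<le> norm (poly p z)"
      using exists_root_nearby[of p z] deg p by auto
    have "?c * dist z r ^ ?n < ?c * e ^ ?n"
      using r(2) w(2) by (simp add: p(3) dist_norm norm_minus_commute)
    then have "dist z r < e"
      using c e by (simp add: power_less_imp_less_base)
    moreover have "r \<in> ?U"
      using r(1) w(1) backward_orbit_invariant[OF zero, of r] by (simp add: p(3))
    ultimately show ?thesis by (auto simp: dist_commute)
  qed
  then show "z \<in> closure ?U" unfolding closure_approachable by blast
qed

text \<open>
  The root sets of the iterates increase because \<open>0\<close> is a fixed point, so the Hausdorff limit is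
  the closure of their union.
\<close>

lemma independence_fractal_eq:
  assumes "pair_graph G" "degree (reduced_indep_poly G) \<ge> 2"
  shows "independence_fractal G = closure (backward_orbit (reduced_indep_poly G))"
proof -
  interpret pair_graph G by fact
  let ?f = "reduced_indep_poly G"
  have fin: "finite (pverts G)" by (rule pair_finite_verts)
  have zero: "poly ?f 0 = 0"
    using coeff_reduced_indep_poly[OF fin, of 0] by (simp add: poly_0_coeff_0)
  have X: "{z. poly (reduced_indep_poly (lex_power G m)) z = 0} = {z. (poly ?f ^^ m) z = 0}" for m
    using poly_reduced_lex_power[OF fin] pair_no_loops by fastforce
  have "mono (\<lambda>m. {z. (poly ?f ^^ m) z = 0})"
    unfolding mono_iff_le_Suc using zero by auto
  then show ?thesis
    unfolding independence_fractal_def X backward_orbit_def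
    by (intro hausdorff_lim_increasing)
      (use bounded_backward_orbit[OF assms(2) zero] in \<open>auto simp: backward_orbit_def\<close>)
qed

section \<open>Polynomials whose preimage of a segment is that segment\<close>

lemma poly_map_of_real: "poly (map_poly of_real p) (complex_of_real x) = of_real (poly p x)"
  by (induction p) (auto simp: map_poly_pCons)

lemma map_poly_of_real_mult:
  "map_poly complex_of_real (p * q) = map_poly of_real p * map_poly of_real q"
  by (simp add: poly_eq_iff coeff_map_poly coeff_mult)

lemma map_poly_of_real_add:
  "map_poly complex_of_real (p + q) = map_poly of_real p + map_poly of_real q"
  by (simp add: poly_eq_iff coeff_map_poly)

lemma poly_nonneg_extend:
  fixes p :: "real poly"
  assumes "finite A" "\<And>x. x \<notin> A \<Longrightarrow> poly p x \<ge> 0"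
  shows "poly p x \<ge> 0"
proof (rule tendsto_lowerbound)
  show "(poly p \<longlongrightarrow> poly p x) (at x)" by (rule tendsto_poly[OF tendsto_ident_at])
  show "\<forall>\<^sub>F y in at x. poly p y \<ge> 0"
    using islimpt_finite[OF assms(1), of x] assms(2)
    by (auto simp: islimpt_iff_eventually elim!: eventually_mono)
qed simp

text \<open>
  At a root of a nonnegative polynomial the derivative vanishes, so the root is double and a
  squared linear factor can be split off.
\<close>

lemma nonneg_real_rooted_is_square:
  fixes p :: "real poly"
  assumes "\<And>x. poly p x \<ge> 0" and "\<And>z. poly (map_poly complex_of_real p) z = 0 \<Longrightarrow> z \<in> \<real>"
  shows "\<exists>q. p = q\<^sup>2"
  using assms
proof (induction "degree p" arbitrary: p rule: less_induct)
  case less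
  show ?case
  proof (cases "degree p = 0")
    case True
    then obtain c where p: "p = [:c:]" by (auto elim: degree_eq_zeroE)
    with less.prems(1)[of 0] have "c \<ge> 0" by simp
    then have "p = [:sqrt c:]\<^sup>2" by (simp add: p power2_eq_square)
    then show ?thesis ..
  next
    case False
    then have "degree (map_poly complex_of_real p) \<noteq> 0" by (simp add: degree_map_poly)
    then obtain z where z: "poly (map_poly complex_of_real p) z = 0"
      using alg_closed_imp_poly_has_root[of "map_poly complex_of_real p"] by auto
    with less.prems(2) obtain r where r: "z = of_real r" by (auto elim: Reals_cases)
    have "poly p r = 0" using z by (simp add: r poly_map_of_real)
    then obtain p1 where p1: "p = [:-r, 1:] * p1" by (auto simp: poly_eq_0_iff_dvd elim: dvdE)
    have "poly (pderiv p) r = 0"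
      by (rule DERIV_local_min[OF poly_DERIV zero_less_one])
        (use less.prems(1) \<open>poly p r = 0\<close> in simp)
    then have "poly p1 r = 0" by (simp add: p1 pderiv_mult pderiv_pCons del: mult_pCons_left)
    then obtain p2 where "p1 = [:-r, 1:] * p2" by (auto simp: poly_eq_0_iff_dvd elim: dvdE)
    then have p: "p = [:-r, 1:]\<^sup>2 * p2" by (simp only: p1 power2_eq_square mult.assoc)
    have "p2 \<noteq> 0" using False p by auto
    then have "degree p2 < degree p" by (simp add: p degree_mult_eq degree_power_eq)
    moreover have "poly p2 x \<ge> 0" for x
    proof (rule poly_nonneg_extend[of "{r}"])
      fix y assume "y \<notin> {r}"
      then have "(y - r)\<^sup>2 > 0" by simp
      moreover have "(y - r)\<^sup>2 * poly p2 y \<ge> 0" using less.prems(1)[of y] by (simp add: p)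
      ultimately show "poly p2 y \<ge> 0" by (simp add: zero_le_mult_iff)
    qed simp
    moreover have "z \<in> \<real>" if "poly (map_poly complex_of_real p2) z = 0" for z
      using less.prems(2)[of z] that by (simp add: p map_poly_of_real_mult)
    ultimately obtain q where "p2 = q\<^sup>2" using less.hyps by blast
    then have "p = ([:-r, 1:] * q)\<^sup>2" by (simp only: p power_mult_distrib)
    then show ?thesis ..
  qed
qed

text \<open>
  On the real line the polynomial \<open>g = f (f + L)\<close> is at most \<open>0\<close> exactly on \<open>[-L, 0]\<close>, and all its
  complex roots lie there. So it changes sign only at the end points, its interior roots have
  even order, and \<open>g = x (x + L) q\<^sup>2\<close>. This is Pell's equation
  \<open>(2 f + L)\<^sup>2 - 4 x (x + L) q\<^sup>2 = L\<^sup>2\<close>; differentiating \<open>g\<close> shows that \<open>q\<close>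
  divides \<open>f' (2 f + L)\<close>, by Pell's equation also \<open>L\<^sup>2 f'\<close>, and comparing degrees and leading
  coefficients gives \<open>f'\<^sup>2 = d\<^sup>2 q\<^sup>2\<close>. The resulting equation is the differential equation of the
  Chebyshev polynomials, transported from \<open>[-1, 1]\<close> to \<open>[-L, 0]\<close>.
\<close>

lemma invariant_segment_chebyshev_equation:
  fixes f :: "real poly"
  assumes L: "L > 0" and deg: "degree f > 0" and zero: "poly f 0 = 0"
    and inv: "\<And>z. poly (map_poly of_real f) z \<in> complex_of_real ` {-L..0} \<longleftrightarrow>
      z \<in> complex_of_real ` {-L..0}"
  shows "smult (of_nat (degree f) ^ 2) (f * (f + [:L:])) = [:0, L, 1:] * (pderiv f)\<^sup>2"
proof -
  define g where "g = f * (f + [:L:])"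
  define X where "X = [:0, L, 1:]"
  let ?d = "degree f"
  have X: "poly X x = x * (x + L)" "degree X = 2" "lead_coeff X = 1" "X \<noteq> 0" for x
    by (simp_all add: X_def algebra_simps)
  have g: "poly g x = poly f x * (poly f x + L)" for x by (simp add: g_def)
  have inv_real: "poly f x \<in> {-L..0} \<longleftrightarrow> x \<in> {-L..0}" for x
    using inv[of "of_real x"] unfolding poly_map_of_real by (auto simp: image_iff)
  have sign: "y * (y + L) \<le> 0 \<longleftrightarrow> y \<in> {-L..0}" for y
    using L by (auto simp: mult_le_0_iff)
  have sign_g: "poly g x \<le> 0 \<longleftrightarrow> x * (x + L) \<le> 0" for x
    using inv_real[of x] unfolding g sign by blast

  \<comment> \<open>Both end points are roots of \<open>g\<close>: at \<open>- L\<close> the sign changes, and \<open>0\<close> is a root of \<open>f\<close>.\<close>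
  have "poly g (- L) \<ge> 0"
  proof (rule tendsto_lowerbound)
    show "(poly g \<longlongrightarrow> poly g (- L)) (at_left (- L))"
      by (rule tendsto_poly[OF tendsto_ident_at])
    show "\<forall>\<^sub>F x in at_left (- L). poly g x \<ge> 0"
    proof (rule eventually_at_leftI[of "- L - 1"])
      fix x assume "x \<in> {- L - 1<..<- L}"
      then have "x \<notin> {-L..0}" by simp
      then show "poly g x \<ge> 0" using sign_g[of x] unfolding sign by linarith
    qed simp
  qed simp
  moreover have "poly g (- L) \<le> 0" unfolding sign_g by simp
  ultimately have "poly g (- L) = 0" by simp
  then obtain g1 where g1: "g = [:L, 1:] * g1"
    using poly_eq_0_iff_dvd[of g "- L"] by (auto elim: dvdE)
  have "poly g 0 = 0" by (simp add: g zero)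
  then have "poly g1 0 = 0" using L by (simp add: g1)
  then obtain p where "g1 = [:0, 1:] * p"
    using poly_eq_0_iff_dvd[of g1 0] by (auto elim: dvdE)
  then have gp: "g = X * p" by (simp add: g1 X_def algebra_simps)

  have "poly p x \<ge> 0" for x
  proof (rule poly_nonneg_extend[of "{-L, 0}"])
    fix y assume "y \<notin> {-L, 0}"
    then have "y * (y + L) \<noteq> 0" by auto
    moreover have "y * (y + L) * poly p y \<le> 0 \<longleftrightarrow> y * (y + L) \<le> 0"
      using sign_g[of y] unfolding gp poly_mult X(1) .
    ultimately show "poly p y \<ge> 0"
      unfolding mult_le_0_iff[of "y * (y + L)" "poly p y"] by linarith
  qed simp
  moreover have "z \<in> \<real>" if "poly (map_poly complex_of_real p) z = 0" for z
  proof -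
    have "poly (map_poly complex_of_real g) z = 0"
      using that unfolding gp map_poly_of_real_mult by simp
    then have "poly (map_poly of_real f) z \<in> complex_of_real ` {0, -L}"
      by (auto simp: g_def map_poly_of_real_mult map_poly_of_real_add map_poly_pCons
          add_eq_0_iff2)
    then have "poly (map_poly of_real f) z \<in> complex_of_real ` {-L..0}"
      using L by auto
    then show ?thesis unfolding inv by auto
  qed
  ultimately obtain q where q: "p = q\<^sup>2"
    using nonneg_real_rooted_is_square[of p] by blast
  have gq: "g = X * q\<^sup>2" using gp q by simp

  have deg_fL: "degree (f + [:L:]) = ?d" using deg by (simp add: degree_add_eq_left)
  have lead_fL: "lead_coeff (f + [:L:]) = lead_coeff f"
    using deg unfolding deg_fL by (cases "degree f") auto
  have "f \<noteq> 0" "f + [:L:] \<noteq> 0" using deg deg_fL by auto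
  then have "degree g = 2 * ?d" and lead_g: "lead_coeff g = (lead_coeff f)\<^sup>2"
    unfolding g_def lead_coeff_mult lead_fL power2_eq_square
    by (simp_all add: degree_mult_eq deg_fL)
  moreover have "q \<noteq> 0" using \<open>f \<noteq> 0\<close> \<open>f + [:L:] \<noteq> 0\<close> gq by (auto simp: g_def)
  then have "degree g = 2 + 2 * degree q"
    unfolding gq using X(2,4) by (simp add: degree_mult_eq degree_power_eq)
  ultimately have deg_q: "degree q = ?d - 1" by simp
  have lead_q: "(lead_coeff q)\<^sup>2 = (lead_coeff f)\<^sup>2"
    using lead_g unfolding gq lead_coeff_mult lead_coeff_power X(3) by simp

  \<comment> \<open>A factor \<open>2 f + L\<close> is traded for the constant \<open>L\<^sup>2\<close>, as \<open>(2 f + L)\<^sup>2 = L\<^sup>2 + 4 g\<close> and \<open>q\<close> divides \<open>g\<close>.\<close>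
  have "pderiv f * (2 * f + [:L:]) = pderiv g"
    by (simp add: g_def pderiv_mult pderiv_add pderiv_smult pderiv_pCons algebra_simps)
  also have "\<dots> = q * (pderiv X * q + 2 * X * pderiv q)"
    by (simp add: gq pderiv_mult power2_eq_square algebra_simps)
  finally have "q dvd pderiv f * (2 * f + [:L:])" by simp
  then have "q dvd pderiv f * (2 * f + [:L:]) * (2 * f + [:L:]) - 4 * (pderiv f * g)"
    unfolding gq by (simp add: power2_eq_square)
  also have "\<dots> = smult (L\<^sup>2) (pderiv f)"
    by (simp add: g_def power2_eq_square algebra_simps)
  finally have "q dvd pderiv f" using L dvd_smult_cancel by force
  then obtain e where e: "pderiv f = q * e" by (auto elim: dvdE)
  have "pderiv f \<noteq> 0" using deg by (simp add: pderiv_eq_0_iff)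
  then have "degree e = 0"
    using deg_q unfolding e by (metis e add_diff_cancel_left' degree_mult_eq degree_pderiv
        diff_self_eq_0 mult_eq_0_iff)
  then obtain a where a: "e = [:a:]" by (auto elim: degree_eq_zeroE)
  have "lead_coeff (pderiv f) = of_nat ?d * lead_coeff f"
    using deg by (simp add: degree_pderiv coeff_pderiv)
  then have "lead_coeff q * a = of_nat ?d * lead_coeff f"
    unfolding e lead_coeff_mult by (simp add: a)
  then have "(lead_coeff q)\<^sup>2 * a\<^sup>2 = of_nat ?d ^ 2 * (lead_coeff f)\<^sup>2"
    by (simp flip: power_mult_distrib)
  then have "a\<^sup>2 = of_nat ?d ^ 2" using \<open>f \<noteq> 0\<close> unfolding lead_q by simp
  then have "(pderiv f)\<^sup>2 = smult (of_nat ?d ^ 2) (q\<^sup>2)"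
    by (simp add: e a power2_eq_square)
  then show ?thesis
    using gq by (simp add: g_def X_def)
qed

text \<open>
  The coefficient of \<open>x\<^sup>j\<close> in the differential equation determines \<open>a\<^sub>j\<close> from the lower coefficients.
\<close>

lemma chebyshev_equation_degree_5:
  fixes f :: "real poly"
  assumes f: "f = [:0, a1, a2, a3, a4, a5:]" and "L > 0" "a1 \<noteq> 0"
    and eq: "smult 25 (f * (f + [:L:])) = [:0, L, 1:] * (pderiv f)\<^sup>2"
  defines "k \<equiv> 4 / L"
  shows "a1 = 25 \<and> a2 = 50 * k \<and> a3 = 35 * k ^ 2 \<and> a4 = 10 * k ^ 3 \<and> a5 = k ^ 4"
proof -
  have c: "coeff (smult 25 (f * (f + [:L:]))) j = coeff ([:0, L, 1:] * (pderiv f)\<^sup>2) j" for j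
    by (simp add: eq)
  note [simp] = f pderiv_pCons power2_eq_square coeff_pCons numeral_eq_Suc
  have L: "L = 4 / k" "k > 0" using \<open>L > 0\<close> by (simp_all add: k_def)
  have a1: "a1 = 25" using c[of 1] \<open>L > 0\<close> \<open>a1 \<noteq> 0\<close> by simp
  have a2: "a2 = 50 * k" using c[of 2] L by (simp add: a1 field_simps)
  have a3: "a3 = 35 * k ^ 2" using c[of 3] L by (simp add: a1 a2 field_simps)
  have a4: "a4 = 10 * k ^ 3" using c[of 4] L by (simp add: a1 a2 a3 field_simps)
  have a5: "a5 = k ^ 4" using c[of 5] L by (simp add: a1 a2 a3 a4 field_simps)
  show ?thesis using a1 a2 a3 a4 a5 by blast
qed

section \<open>The backward orbit of a Chebyshev polynomial\<close>

text \<open>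
  For \<open>k \<noteq> 0\<close> this is the Chebyshev polynomial \<open>T\<^sub>5\<close>, conjugated by the affine map that takes \<open>-1\<close> and
  \<open>1\<close> to \<open>- 4 / k\<close> and \<open>0\<close>.
\<close>

definition chebyshev5 :: "'a::comm_ring_1 \<Rightarrow> 'a poly" where
  "chebyshev5 k = [:0, 25, 50 * k, 35 * k ^ 2, 10 * k ^ 3, k ^ 4:]"

lemma sin_times_5:
  fixes t :: complex
  shows "sin (5 * t) = sin t * (16 * sin t ^ 4 - 20 * sin t ^ 2 + 5)"
proof -
  define s c where "s = sin t" and "c = cos t"
  have c: "c\<^sup>2 = 1 - s\<^sup>2" by (simp add: s_def c_def cos_squared_eq)
  have "sin (5 * t) = sin (2 * (2 * t) + t)" by simp
  also have "\<dots> = 2 * (2 * s * c) * (1 - 2 * s\<^sup>2) * c + (1 - 2 * (2 * s * c)\<^sup>2) * s"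
    unfolding sin_add sin_double cos_double_sin s_def c_def by simp
  also have "\<dots> = 4 * s * (1 - 2 * s\<^sup>2) * c\<^sup>2 + (1 - 8 * s\<^sup>2 * c\<^sup>2) * s"
    by (simp add: power2_eq_square algebra_simps)
  also have "\<dots> = s * (16 * s ^ 4 - 20 * s ^ 2 + 5)"
    unfolding c by (simp add: power2_eq_square power4_eq_xxxx algebra_simps)
  finally show ?thesis by (simp add: s_def)
qed

text \<open>In the coordinate \<open>-(4/k) sin\<^sup>2 t\<close> the polynomial is multiplication of the angle by five.\<close>

lemma poly_chebyshev5:
  fixes t k :: complex
  assumes "k \<noteq> 0"
  shows "poly (chebyshev5 k) (- (4 / k) * (sin t)\<^sup>2) = - (4 / k) * (sin (5 * t))\<^sup>2"
proof -
  have "poly (chebyshev5 k) (- (4 / k) * s\<^sup>2) = - (4 / k) * (s * (16 * s ^ 4 - 20 * s ^ 2 + 5))\<^sup>2" for s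
    using assms by (simp add: chebyshev5_def field_simps) algebra
  then show ?thesis by (simp add: sin_times_5)
qed

lemma funpow_poly_chebyshev5:
  fixes t k :: complex
  assumes "k \<noteq> 0"
  shows "(poly (chebyshev5 k) ^^ m) (- (4 / k) * (sin t)\<^sup>2) = - (4 / k) * (sin (5 ^ m * t))\<^sup>2"
proof (induction m)
  case (Suc m)
  then show ?case using poly_chebyshev5[OF assms, of "5 ^ m * t"] by (simp add: mult.assoc)
qed simp

text \<open>
  Every complex number has the form \<open>-(4/k) sin\<^sup>2 t\<close> with a complex angle \<open>t\<close>. An iterate vanishes
  there if and only if \<open>5\<^sup>m t\<close> is a zero of the sine, and the complex sine has only real zeros.
\<close>

lemma backward_orbit_chebyshev5:
  fixes k :: real
  assumes k: "k \<noteq> 0"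
  shows "backward_orbit (chebyshev5 (of_real k)) =
    {of_real (- (4 / k) * (sin (of_int j * pi / 5 ^ m))\<^sup>2) |j m. True}"
proof -
  let ?k = "complex_of_real k"
  let ?z = "\<lambda>t. - (4 / ?k) * (sin t)\<^sup>2"
  have k': "?k \<noteq> 0" using k by simp
  have iff: "?z t \<in> backward_orbit (chebyshev5 ?k) \<longleftrightarrow>
      (\<exists>j m. t = of_real (of_int j * pi / 5 ^ m))" for t
  proof -
    have "(sin (5 ^ m * t) = 0) = (\<exists>j. t = of_real (of_int j * pi / 5 ^ m))" for m
      by (auto simp: sin_eq_0 field_simps)
    then show ?thesis
      unfolding backward_orbit_iff funpow_poly_chebyshev5[OF k'] using k' by auto
  qed
  have surj: "\<exists>t. z = ?z t" for z
    by (rule exI[of _ "Arcsin (csqrt (- ?k * z / 4))"]) (use k in simp)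
  have real: "?z (of_real x) = of_real (- (4 / k) * (sin x)\<^sup>2)" for x
    by (simp add: sin_of_real)
  show ?thesis
  proof (intro equalityI subsetI)
    fix z assume z: "z \<in> backward_orbit (chebyshev5 ?k)"
    obtain t where t: "z = ?z t" using surj by blast
    then obtain j m where "t = of_real (of_int j * pi / 5 ^ m)" using z iff by blast
    then show "z \<in> {of_real (- (4 / k) * (sin (of_int j * pi / 5 ^ m))\<^sup>2) |j m. True}"
      unfolding t by (simp only: real) blast
  next
    fix z assume "z \<in> {complex_of_real (- (4 / k) * (sin (of_int j * pi / 5 ^ m))\<^sup>2) |j m. True}"
    then obtain j m where "z = of_real (- (4 / k) * (sin (of_int j * pi / 5 ^ m))\<^sup>2)" by blast
    then show "z \<in> backward_orbit (chebyshev5 ?k)"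
      unfolding real[symmetric] using iff by blast
  qed
qed

text \<open>The angles \<open>j \<pi> / 5\<^sup>m\<close> are dense in the reals.\<close>

lemma closure_backward_orbit_chebyshev5:
  fixes k :: real
  assumes k: "k > 0"
  shows "closure (backward_orbit (chebyshev5 (of_real k))) = of_real ` {- (4 / k)..0}"
proof -
  let ?U = "backward_orbit (chebyshev5 (complex_of_real k))"
  let ?h = "\<lambda>x::real. - (4 / k) * (sin x)\<^sup>2"
  have U: "?U = {of_real (?h (of_int j * pi / 5 ^ m)) |j m. True}"
    using backward_orbit_chebyshev5[of k] k by simp
  have "?h x \<in> {- (4 / k)..0}" for x
    using k power_le_one[of "\<bar>sin x\<bar>" 2] by (auto simp: field_simps)
  then have sub: "?U \<subseteq> of_real ` {- (4 / k)..0}"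
    unfolding U by blast
  have "closed (complex_of_real ` {- (4 / k)..0})"
    by (intro compact_imp_closed compact_continuous_image continuous_intros compact_Icc)
  then have "closure ?U \<subseteq> of_real ` {- (4 / k)..0}" by (rule closure_minimal[OF sub])
  moreover have "of_real y \<in> closure ?U" if y: "y \<in> {- (4 / k)..0}" for y
  proof -
    define x where "x = arcsin (sqrt (- k * y / 4))"
    have "0 \<le> - k * y / 4" "- k * y / 4 \<le> 1"
      using y k by (auto simp: field_simps mult_le_0_iff)
    then have sq: "0 \<le> sqrt (- k * y / 4)" "sqrt (- k * y / 4) \<le> 1"
      "(sqrt (- k * y / 4))\<^sup>2 = - k * y / 4" by auto
    have "sin x = sqrt (- k * y / 4)"
      unfolding x_def by (rule sin_arcsin[OF order_trans[OF _ sq(1)] sq(2)]) simp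
    then have hx: "?h x = y" using sq(3) k by simp
    \<comment> \<open>The multiples of \<open>\<pi> / 5\<^sup>m\<close> just below \<open>x\<close>.\<close>
    define X where "X = (\<lambda>m. of_int \<lfloor>5 ^ m * x / pi\<rfloor> * pi / 5 ^ m)"
    have "\<bar>X m - x\<bar> \<le> pi / 5 ^ m" for m
    proof -
      have "X m - x = (of_int \<lfloor>5 ^ m * x / pi\<rfloor> - 5 ^ m * x / pi) * (pi / 5 ^ m)"
        by (simp add: X_def field_simps)
      also have "\<bar>\<dots>\<bar> = \<bar>of_int \<lfloor>5 ^ m * x / pi\<rfloor> - 5 ^ m * x / pi\<bar> * (pi / 5 ^ m)"
        by (simp add: abs_mult)
      also have "\<dots> \<le> 1 * (pi / 5 ^ m)"
        by (rule mult_right_mono, linarith) simp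
      finally show ?thesis by simp
    qed
    then have "(\<lambda>m. X m - x) \<longlonglongrightarrow> 0"
      by (intro Lim_null_comparison[OF _ LIMSEQ_divide_realpow_zero[of 5 pi]]) auto
    then have "X \<longlonglongrightarrow> x" by (simp add: LIM_zero_iff)
    then have "(\<lambda>m. complex_of_real (?h (X m))) \<longlonglongrightarrow> of_real (?h x)"
      by (intro tendsto_intros)
    moreover have "complex_of_real (?h (X m)) \<in> ?U" for m
      unfolding U X_def by blast
    ultimately show ?thesis
      unfolding hx closure_sequential
      by (intro exI[of _ "\<lambda>m. complex_of_real (?h (X m))"] conjI allI)
  qed
  ultimately show ?thesis by blast
qed

section \<open>Segments as closures of backward orbits\<close>

text \<open>Vieta's formula for the second highest coefficient, with roots counted by multiplicity.\<close>

lemma exists_roots_with_sum: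
  fixes p :: "complex poly"
  assumes "degree p = Suc n"
  shows "\<exists>A. (\<forall>x\<in>#A. poly p x = 0) \<and> coeff p n = - lead_coeff p * sum_mset A"
proof -
  have "p \<noteq> 0" using assms by auto
  then obtain A where A: "size A = degree p"
      "p = smult (lead_coeff p) (\<Prod>x\<in>#A. [:-x, 1:])"
    using alg_closed_imp_factorization by blast
  let ?P = "\<lambda>B. \<Prod>x\<in>#B. [:- (x :: complex), 1:]"
  have deg: "degree (?P B) \<le> size B" for B
  proof (induction B)
    case (add x B)
    then show ?case using degree_mult_le[of "[:-x, 1:]" "?P B"] by simp
  qed simp
  have "coeff (?P B) (size B) = 1 \<and> (\<forall>m. size B = Suc m \<longrightarrow> coeff (?P B) m = - sum_mset B)" for B
  proof (induction B)
    case (add x B)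
    have "coeff (?P B) (Suc (size B)) = 0"
      using deg[of B] by (intro coeff_eq_0) simp
    then show ?case using add by (cases "size B") (auto simp: coeff_pCons)
  qed simp
  then have "coeff (?P A) n = - sum_mset A" using A(1) assms by simp
  then have "coeff p n = - lead_coeff p * sum_mset A"
    by (subst A(2)) simp
  moreover have "poly p x = 0" if "x \<in># A" for x
  proof -
    have "poly (?P B) x = 0" if "x \<in># B" for B
      using that by (induction B) auto
    then show ?thesis using that by (subst A(2)) simp
  qed
  ultimately show ?thesis by blast
qed

text \<open>
  The segment lies on a line through \<open>0\<close>. The sum of the roots of \<open>f\<close> is a nonzero real number on
  that line, because by Vieta it is the negative quotient of two positive coefficients; so the line is
  the real axis. A polynomial with positive coefficients has no
  positive roots, and neither have its iterates, so the segment ends at \<open>0\<close>.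
\<close>

lemma segment_backward_orbit_is_real:
  fixes f :: "real poly"
  assumes deg: "degree f = Suc n" and zero: "poly f 0 = 0"
    and pos: "\<And>j. 0 < j \<Longrightarrow> j \<le> degree f \<Longrightarrow> coeff f j > 0" and n: "n > 0"
    and seg: "closure (backward_orbit (map_poly of_real f)) = closed_segment a b" "a \<noteq> b"
  shows "\<exists>L>0. closure (backward_orbit (map_poly of_real f)) = of_real ` {-L..0}"
proof -
  let ?f = "map_poly complex_of_real f"
  let ?K = "closure (backward_orbit ?f)"
  have deg_f: "degree ?f = Suc n" using deg by (simp add: degree_map_poly)
  have "0 \<in> ?K" using zero_in_backward_orbit closure_subset by blast
  then obtain s where s: "0 = (1 - s) *\<^sub>R a + s *\<^sub>R b"
    unfolding seg closed_segment_def by blast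
  have line: "\<exists>t. z = of_real t * (b - a)" if z: "z \<in> ?K" for z
  proof -
    obtain t where "z = (1 - t) *\<^sub>R a + t *\<^sub>R b"
      using z unfolding seg closed_segment_def by blast
    then have "z = (t - s) *\<^sub>R (b - a)" using s by (simp add: algebra_simps)
    then show ?thesis unfolding scaleR_conv_of_real by blast
  qed
  obtain A where A: "\<And>x. x \<in># A \<Longrightarrow> poly ?f x = 0"
      "coeff ?f n = - lead_coeff ?f * sum_mset A"
    using exists_roots_with_sum[OF deg_f] by blast
  have root: "\<exists>t. x = of_real t * (b - a)" if "x \<in># A" for x
    using line roots_in_backward_orbit[OF A(1)[OF that]] closure_subset by blast
  have "\<exists>t. sum_mset B = of_real t * (b - a)" if "B \<subseteq># A" for B
    using that
  proof (induction B)
    case empty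
    show ?case by (rule exI[of _ 0]) simp
  next
    case (add x B)
    then have "B \<subseteq># A" "x \<in># A"
      by (auto dest: mset_subset_eq_insertD simp: subset_mset.less_imp_le)
    then obtain t t' where "sum_mset B = of_real t * (b - a)" "x = of_real t' * (b - a)"
      using add.IH root by blast
    then have "sum_mset (add_mset x B) = of_real (t' + t) * (b - a)"
      by (simp only: sum_mset.add_mset of_real_add distrib_right)
    then show ?case by blast
  qed
  then obtain t where t: "sum_mset A = of_real t * (b - a)" by blast
  have coeffs: "coeff f n > 0" "lead_coeff f > 0" using pos deg n by auto
  have "of_real (coeff f n) = - of_real (lead_coeff f) * (of_real t * (b - a))"
    using A(2) deg deg_f by (simp add: t coeff_map_poly)
  then have eq: "of_real (coeff f n) = of_real (- lead_coeff f * t) * (b - a)" by simp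
  then have "t \<noteq> 0" using coeffs by auto
  then have "- lead_coeff f * t \<noteq> 0" using coeffs by auto
  then have "b - a = of_real (coeff f n / (- lead_coeff f * t))"
    using eq by (metis nonzero_mult_div_cancel_left of_real_divide of_real_eq_0_iff)
  then obtain u where u: "b - a = complex_of_real u" by blast
  have real: "z \<in> range complex_of_real" if "z \<in> ?K" for z
    using line[OF that] by (auto simp: u simp flip: of_real_mult)

  have f_pos: "poly f x > 0" if "x > 0" for x
  proof -
    have "coeff f j \<ge> 0" if "j \<le> degree f" for j
      using pos[of j] that zero by (cases "j = 0") (auto simp: poly_0_coeff_0)
    moreover have "coeff f (degree f) * x ^ degree f > 0"
      using coeffs \<open>x > 0\<close> by simp
    ultimately show ?thesis
      unfolding poly_altdef using \<open>x > 0\<close> by (intro sum_pos2[of _ "degree f"]) auto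
  qed
  have iter: "(poly ?f ^^ m) (of_real x) = of_real ((poly f ^^ m) x)" for m x
    by (induction m) (simp_all add: poly_map_of_real)
  have "x \<le> 0" if "of_real x \<in> backward_orbit ?f" for x
  proof (rule ccontr)
    assume "\<not> x \<le> 0"
    then have "(poly f ^^ m) x > 0" for m
      by (induction m) (auto intro: f_pos)
    then show False
      using that unfolding backward_orbit_iff iter by (metis less_irrefl of_real_eq_0_iff)
  qed
  then have "backward_orbit ?f \<subseteq> {z. Re z \<le> 0}"
    using real closure_subset[of "backward_orbit ?f"] by fastforce
  then have "?K \<subseteq> {z. Re z \<le> 0}"
    by (rule closure_minimal) (rule closed_halfspace_Re_le)
  moreover have mem: "a \<in> ?K" "b \<in> ?K" unfolding seg by auto
  ultimately have "Re a \<le> 0" "Re b \<le> 0" by blast+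
  moreover obtain \<alpha> \<beta> where "a = of_real \<alpha>" "b = of_real \<beta>"
    using real mem by blast
  ultimately have ab: "a = of_real \<alpha>" "b = of_real \<beta>" "\<alpha> \<le> 0" "\<beta> \<le> 0" by simp_all
  have K: "?K = of_real ` closed_segment \<alpha> \<beta>"
    unfolding seg ab by (rule closed_segment_of_real)
  have "0 \<in> closed_segment \<alpha> \<beta>" using \<open>0 \<in> ?K\<close> unfolding K by auto
  then have "closed_segment \<alpha> \<beta> = {- (- \<alpha> - \<beta>)..0}" "- \<alpha> - \<beta> > 0"
    using ab seg(2) by (auto simp: closed_segment_eq_real_ivl split: if_splits)
  then show ?thesis unfolding K by blast
qed

text \<open>
  Since \<open>a\<^sup>n = c\<^sup>n b\<close>, unique factorization lets \<open>c\<close> divide \<open>a\<close>. This will be applied to the second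
  and the last coefficient, \<open>50 k\<close> and \<open>k\<^sup>4\<close>, to see that \<open>k\<close> is an integer.
\<close>

lemma nat_if_multiple_and_power_nat:
  fixes k :: real and c a b n :: nat
  assumes "real a = real c * k" "real b = k ^ n" "n > 0" "c > 0"
  shows "\<exists>m::nat. k = real m"
proof -
  have "real (a ^ n) = real (c ^ n * b)"
    using assms(1,2) by (simp add: power_mult_distrib)
  then have "c ^ n dvd a ^ n" by (simp only: of_nat_eq_iff) simp
  then have "c dvd a" using assms(3) by simp
  then obtain m where "a = c * m" by (auto elim: dvdE)
  then show ?thesis using assms(1,4) by auto
qed

section \<open>Graphs with independence number five\<close>

lemma reduced_indep_poly_5:
  assumes "finite (pverts G)" "independence_number G = 5"
  shows "reduced_indep_poly G = map_poly of_real [:0, real (num_indep_sets G 1),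
    real (num_indep_sets G 2), real (num_indep_sets G 3), real (num_indep_sets G 4),
    real (num_indep_sets G 5):]"
  using assms(2)
  by (auto simp: poly_eq_iff coeff_reduced_indep_poly[OF assms(1)] coeff_map_poly coeff_pCons
      numeral_eq_Suc split: nat.splits)

theorem theorem2p2:
  fixes G :: "'a pair_pre_digraph"
  assumes "pair_graph G"
    and "independence_number G = 5"
  shows "(\<exists>a b :: complex. a \<noteq> b \<and> independence_fractal G = closed_segment a b) \<longleftrightarrow>
    (\<exists>k \<in> {1, 2, 3, 4, 5 :: nat}.
      reduced_indep_poly G =
        [:0, 25, 50 * of_nat k, 35 * of_nat k ^ 2, 10 * of_nat k ^ 3, of_nat k ^ 4:])"
    (is "?segment \<longleftrightarrow> ?form")
proof -
  interpret pair_graph G by fact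
  have fin: "finite (pverts G)" by (rule pair_finite_verts)
  let ?i = "\<lambda>j. real (num_indep_sets G j)"
  define f where "f = [:0, ?i 1, ?i 2, ?i 3, ?i 4, ?i 5:]"
  have i_pos: "?i j > 0" if "j \<le> 5" for j
    using num_indep_sets_pos[OF fin] that assms(2) by simp
  have F: "reduced_indep_poly G = map_poly of_real f"
    unfolding f_def by (rule reduced_indep_poly_5[OF fin assms(2)])
  have deg: "degree f = 5" using i_pos[of 5] by (simp add: f_def)
  have fractal: "independence_fractal G = closure (backward_orbit (map_poly of_real f))"
    using independence_fractal_eq[OF assms(1)] deg by (simp add: F degree_map_poly)
  show ?thesis
  proof
    assume ?segment
    then obtain a b :: complex
      where ab: "closure (backward_orbit (map_poly of_real f)) = closed_segment a b" "a \<noteq> b"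
      unfolding fractal by blast
    have pos: "coeff f j > 0" if "0 < j" "j \<le> degree f" for j
    proof -
      have "j = 1 \<or> j = 2 \<or> j = 3 \<or> j = 4 \<or> j = 5" using that unfolding deg by linarith
      then show ?thesis using i_pos by (auto simp: f_def numeral_eq_Suc)
    qed
    have zero: "poly f 0 = 0" by (simp add: f_def)
    obtain L where L: "L > 0"
        and K: "closure (backward_orbit (map_poly of_real f)) = of_real ` {-L..0}"
      using segment_backward_orbit_is_real[OF _ zero pos _ ab, of 4] deg by auto
    have "poly (map_poly of_real f) z \<in> complex_of_real ` {-L..0} \<longleftrightarrow>
        z \<in> complex_of_real ` {-L..0}" for z
      unfolding K[symmetric]
      by (rule closure_backward_orbit_invariant)
        (use deg zero poly_map_of_real[of f 0] in \<open>simp_all add: degree_map_poly\<close>)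
    then have "smult (of_nat (degree f) ^ 2) (f * (f + [:L:])) = [:0, L, 1:] * (pderiv f)\<^sup>2"
      using L deg zero by (intro invariant_segment_chebyshev_equation) auto
    then have eq: "smult 25 (f * (f + [:L:])) = [:0, L, 1:] * (pderiv f)\<^sup>2"
      unfolding deg by simp
    define k where "k = 4 / L"
    have "?i 1 \<noteq> 0" using i_pos[of 1] by simp
    then have i: "?i 1 = 25" "?i 2 = 50 * k" "?i 3 = 35 * k ^ 2" "?i 4 = 10 * k ^ 3" "?i 5 = k ^ 4"
      using chebyshev_equation_degree_5[OF f_def L _ eq] unfolding k_def by blast+
    obtain m where m: "k = real m"
      using nat_if_multiple_and_power_nat[of _ 50 k _ 4] i(2,5) by auto
    \<comment> \<open>Not all \<open>300\<close> pairs of the \<open>25\<close> vertices are independent, so \<open>50 m < 300\<close>.\<close>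
    have "card (pverts G) = 25" using i(1) num_indep_sets_1[of G] by simp
    then have "num_indep_sets G 2 < 25 choose 2"
      using num_indep_sets_2_less[OF fin] assms(2) by simp
    moreover have "num_indep_sets G 2 = 50 * m" using i(2) unfolding m by linarith
    ultimately have "m < 6" by (simp add: choose_two)
    moreover have "m > 0" using L m unfolding k_def by (cases m) auto
    ultimately have "m \<in> {1, 2, 3, 4, 5}" by auto
    moreover have "reduced_indep_poly G =
        [:0, 25, 50 * of_nat m, 35 * of_nat m ^ 2, 10 * of_nat m ^ 3, of_nat m ^ 4:]"
      unfolding F f_def i m by (simp add: map_poly_pCons)
    ultimately show ?form by blast
  next
    assume ?form
    then obtain m :: nat where m: "m \<in> {1, 2, 3, 4, 5}"
        "reduced_indep_poly G = chebyshev5 (of_real (real m))"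
      unfolding chebyshev5_def of_real_of_nat_eq by blast
    have "real m > 0" using m(1) by auto
    then have "independence_fractal G = of_real ` {- (4 / real m)..0}"
      using closure_backward_orbit_chebyshev5[of "real m"] unfolding fractal F[symmetric] m(2) by simp
    also have "\<dots> = closed_segment (of_real (- (4 / real m))) (of_real 0)"
      unfolding closed_segment_of_real by (simp add: closed_segment_eq_real_ivl)
    finally show ?segment using m(1) by (intro exI conjI) auto
  qed
qed

end
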